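(* Let $M\ge 2$, let $\tau_1,\dots,\tau_k$ be the $k$ highest-priority tasks of an arbitrary-deadline sporadic task set scheduled by global fixed-priority preemptive scheduling on $M$ identical processors, and suppose that all jobs of $\tau_1,\dots,\tau_{k-1}$ always meet their deadlines. Task $\tau_k$ is schedulable if for every $\ell\in\mathbb{N}=\{1,2,\dots\}$ there exists $\rho$ with $1\ge\rho\ge\frac{\ell C_k}{(\ell-1)T_k+D_k}$ such that $$\frac{\ell C_k}{D_k'}+\sum_{\tau_i\in\mathbf{T}^{carry\text{-}approx}}\frac{\gamma_iU_iD_i}{D_k'}+\sum_{i=1}^{k-1}\left(\frac{C_i-C_iU_i}{D_k'}+U_i\right)\le\mu_k ,$$ where $D_k'=(\ell-1)T_k+D_k$, $\mu_k=M-(M-1)\rho$, $\gamma_i=1$ if $U_i>\rho$ and $\gamma_i=0$ if $U_i\le\rho$, and $\mathbf{T}^{carry\text{-}approx}$ is the set of the $\lceil\mu_k\rceil-1$ tasks among $\tau_1,\dots,\tau_{k-1}$ with the largest values of $\gamma_iU_iD_i$ (it may contain fewer than $\lceil\mu_k\rceil-1$ tasks if fewer than $\lceil\mu_k\rceil-1$ of these tasks have $U_i>\rho$). If $D_k\le T_k$, it suffices that this condition holds for $\ell=1$ only.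
   Context: Model. There are $M\ge2$ identical unit-speed processors. A sporadic task $\tau_i$ has worst-case execution time $C_i>0$, minimum inter-arrival time $T_i>0$, relative deadline $D_i>0$ and utilization $U_i=C_i/T_i$; it is assumed that $C_i\le D_i$ and $U_i\le1$, with no relation required between $D_i$ and $T_i$ (arbitrary deadlines). Task $\tau_i$ releases an infinite sequence of jobs whose consecutive arrivals are at least $T_i$ apart; each job needs at most $C_i$ units of execution, and a job arriving at $t$ must finish by its absolute deadline $t+D_i$. Preemption and migration cost nothing. At any instant at most one job of each task executes, on at most one processor; jobs of the same task are executed in arrival order. Global fixed-priority preemptive scheduling: tasks have unique fixed priorities, $\tau_i$ having higher priority than $\tau_j$ iff $i<j$; at each instant, among the tasks having an arrived and unfinished job, the $M$ highest-priority ones (all of them if fewer than $M$) execute. A task is schedulable if in every schedule so produced, for every legal arrival sequence, all its jobs meet their deadlines. *)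

theory Defs
  imports "HOL-Analysis.Analysis"
begin

record task =
  wcet :: real
  period :: real  \<comment> \<open>minimum inter-arrival time\<close>
  deadline :: real  \<comment> \<open>relative deadline, unrelated to the period\<close>

definition util :: "task \<Rightarrow> real" where
  "util x = wcet x / period x"

definition valid_task :: "task \<Rightarrow> bool" where
  "valid_task x \<longleftrightarrow> 0 < wcet x \<and> 0 < period x \<and> 0 < deadline x
     \<and> wcet x \<le> deadline x \<and> util x \<le> 1"

text \<open>
  A task set consists of the tasks \<open>\<tau> 1, \<dots>, \<tau> n\<close>; a smaller index means a higher priority.
  Jobs of a task are numbered from 0 in arrival order: \<open>a i j\<close> is the arrival time and \<open>c i j\<close> the
  execution requirement of job \<open>j\<close> of task \<open>i\<close>. Time is the whole real line; no common start
  time is imposed.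
\<close>

definition legal_arrivals :: "nat \<Rightarrow> (nat \<Rightarrow> task) \<Rightarrow> (nat \<Rightarrow> nat \<Rightarrow> real) \<Rightarrow> bool" where
  "legal_arrivals n \<tau> a \<longleftrightarrow> (\<forall>i\<in>{1..n}. \<forall>j. a i j + period (\<tau> i) \<le> a i (Suc j))"

definition legal_costs :: "nat \<Rightarrow> (nat \<Rightarrow> task) \<Rightarrow> (nat \<Rightarrow> nat \<Rightarrow> real) \<Rightarrow> bool" where
  "legal_costs n \<tau> c \<longleftrightarrow> (\<forall>i\<in>{1..n}. \<forall>j. 0 \<le> c i j \<and> c i j \<le> wcet (\<tau> i))"

text \<open>
  \<open>S p t = Some (i, j)\<close> means that processor \<open>p\<close> runs job \<open>j\<close> of task \<open>i\<close> at time \<open>t\<close>;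
  the processors are \<open>{..<M}\<close>.
\<close>

type_synonym schedule = "nat \<Rightarrow> real \<Rightarrow> (nat \<times> nat) option"

definition executes :: "nat \<Rightarrow> schedule \<Rightarrow> nat \<Rightarrow> nat \<Rightarrow> real \<Rightarrow> bool" where
  "executes M S i j t \<longleftrightarrow> (\<exists>p<M. S p t = Some (i, j))"

definition service :: "nat \<Rightarrow> schedule \<Rightarrow> nat \<Rightarrow> nat \<Rightarrow> real \<Rightarrow> real" where
  "service M S i j t = measure lebesgue {s. s < t \<and> executes M S i j s}"

definition pending :: "nat \<Rightarrow> (nat \<Rightarrow> nat \<Rightarrow> real) \<Rightarrow> (nat \<Rightarrow> nat \<Rightarrow> real) \<Rightarrow> schedule
    \<Rightarrow> nat \<Rightarrow> nat \<Rightarrow> real \<Rightarrow> bool" where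
  "pending M a c S i j t \<longleftrightarrow> a i j \<le> t \<and> service M S i j t < c i j"

definition active :: "nat \<Rightarrow> (nat \<Rightarrow> nat \<Rightarrow> real) \<Rightarrow> (nat \<Rightarrow> nat \<Rightarrow> real) \<Rightarrow> schedule
    \<Rightarrow> nat \<Rightarrow> real \<Rightarrow> bool" where
  "active M a c S i t \<longleftrightarrow> (\<exists>j. pending M a c S i j t)"

text \<open>
  The first conjunct makes \<open>service\<close> meaningful. The second says that a task runs at most one job at
  a time, on at most one processor; the third that only arrived and unfinished jobs of the task set
  run, in arrival order; the last that exactly the \<open>M\<close> highest-priority active tasks run (all
  active tasks if there are fewer than \<open>M\<close>).
\<close>

definition gfp_schedule :: "nat \<Rightarrow> nat \<Rightarrow> (nat \<Rightarrow> nat \<Rightarrow> real) \<Rightarrow> (nat \<Rightarrow> nat \<Rightarrow> real)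
    \<Rightarrow> schedule \<Rightarrow> bool" where
  "gfp_schedule M n a c S \<longleftrightarrow>
     (\<forall>i j. {t. executes M S i j t} \<in> sets lebesgue) \<and>
     (\<forall>t p q i j j'. p < M \<longrightarrow> q < M \<longrightarrow> S p t = Some (i, j) \<longrightarrow> S q t = Some (i, j') \<longrightarrow> p = q) \<and>
     (\<forall>i j t. executes M S i j t \<longrightarrow>
        i \<in> {1..n} \<and> pending M a c S i j t \<and> (\<forall>j'<j. \<not> pending M a c S i j' t)) \<and>
     (\<forall>i\<in>{1..n}. \<forall>t. active M a c S i t \<longrightarrow>
        ((\<exists>j. executes M S i j t) \<longleftrightarrow> card {h \<in> {1..<i}. active M a c S h t} < M))"

definition schedulable :: "nat \<Rightarrow> nat \<Rightarrow> (nat \<Rightarrow> task) \<Rightarrow> nat \<Rightarrow> bool" where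
  "schedulable M n \<tau> i \<longleftrightarrow>
     (\<forall>a c S. legal_arrivals n \<tau> a \<longrightarrow> legal_costs n \<tau> c \<longrightarrow> gfp_schedule M n a c S \<longrightarrow>
        (\<forall>j. c i j \<le> service M S i j (a i j + deadline (\<tau> i))))"

definition gamma :: "(nat \<Rightarrow> task) \<Rightarrow> real \<Rightarrow> nat \<Rightarrow> real" where
  "gamma \<tau> \<rho> i = (if util (\<tau> i) > \<rho> then 1 else 0)"

definition mu :: "nat \<Rightarrow> real \<Rightarrow> real" where
  "mu M \<rho> = real M - (real M - 1) * \<rho>"

text \<open>The length \<open>D\<^sub>k'\<close> of the window for \<open>l \<ge> 1\<close> jobs of task \<open>k\<close>.\<close>

definition window :: "(nat \<Rightarrow> task) \<Rightarrow> nat \<Rightarrow> nat \<Rightarrow> real" where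
  "window \<tau> k l = (real l - 1) * period (\<tau> k) + deadline (\<tau> k)"

text \<open>
  \<open>X\<close> consists of \<open>\<lceil>\<mu>\<^sub>k\<rceil> - 1\<close> tasks of higher priority than \<open>k\<close> with the largest values of
  \<open>\<gamma>\<^sub>i U\<^sub>i D\<^sub>i\<close>, or of all those with \<open>U\<^sub>i > \<rho>\<close> if these are fewer. In case of ties there are several
  such \<open>X\<close>, all with the same sum of these values.
\<close>

definition carry_approx :: "nat \<Rightarrow> (nat \<Rightarrow> task) \<Rightarrow> nat \<Rightarrow> real \<Rightarrow> nat set \<Rightarrow> bool" where
  "carry_approx M \<tau> k \<rho> X \<longleftrightarrow>
     X \<subseteq> {i \<in> {1..<k}. util (\<tau> i) > \<rho>} \<and>
     card X = min (nat (\<lceil>mu M \<rho>\<rceil> - 1)) (card {i \<in> {1..<k}. util (\<tau> i) > \<rho>}) \<and>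
     (\<forall>i\<in>X. \<forall>h\<in>{1..<k} - X.
        gamma \<tau> \<rho> h * util (\<tau> h) * deadline (\<tau> h) \<le> gamma \<tau> \<rho> i * util (\<tau> i) * deadline (\<tau> i))"

definition test_condition :: "nat \<Rightarrow> (nat \<Rightarrow> task) \<Rightarrow> nat \<Rightarrow> nat \<Rightarrow> bool" where
  "test_condition M \<tau> k l \<longleftrightarrow>
     (\<exists>\<rho> X. \<rho> \<le> 1 \<and> real l * wcet (\<tau> k) / window \<tau> k l \<le> \<rho> \<and> carry_approx M \<tau> k \<rho> X \<and>
        real l * wcet (\<tau> k) / window \<tau> k l
        + (\<Sum>i\<in>X. gamma \<tau> \<rho> i * util (\<tau> i) * deadline (\<tau> i) / window \<tau> k l)
        + (\<Sum>i\<in>{1..<k}. (wcet (\<tau> i) - wcet (\<tau> i) * util (\<tau> i)) / window \<tau> k l + util (\<tau> i))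
        \<le> mu M \<rho>)"

end

theory Submission
  imports Defs
begin

text \<open>
  Suppose a job of task \<open>k\<close> misses its deadline at \<open>v\<close>, and let \<open>t\<^sub>0\<close> be the start of the busy
  period of task \<open>k\<close> containing it, which is the arrival of the first of \<open>l\<close> jobs. Whenever task
  \<open>k\<close> waits in \<open>[t\<^sub>0, v)\<close>, all processors run higher-priority tasks, so that the higher-priority
  work in \<open>[t\<^sub>0, v)\<close> plus \<open>l C\<^sub>k\<close> exceeds \<open>\<mu> (v - t\<^sub>0)\<close>. Extend the window to the left to
  the least \<open>t\<close> for which work plus \<open>l C\<^sub>k\<close> is still at least \<open>\<mu> (v - t)\<close>. The average
  higher-priority load on every interval ending at \<open>t\<close> is then below \<open>\<mu>\<close>. This has two
  consequences: fewer than \<open>\<mu>\<close> tasks have a carry-in job at \<open>t\<close>; and a carry-in task executes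
  for at least a fraction \<open>\<rho>\<close> of its busy period before \<open>t\<close>, so its carry-in does not
  increase the bound on its work after \<open>t\<close> if \<open>U\<^sub>i \<le> \<rho>\<close>, and increases it by at most
  \<open>U\<^sub>i D\<^sub>i\<close> otherwise. Summing the bounds contradicts the test, where strictness comes from
  \<open>t < t\<^sub>0\<close>.
\<close>

section \<open>Measure of a set of instants within a half-open interval\<close>

definition amount :: "real set \<Rightarrow> real \<Rightarrow> real \<Rightarrow> real" where
  "amount X u v = measure lebesgue (X \<inter> {u..<v})"

lemma lmeasurable_Int_Ico:
  fixes u v :: real
  assumes "X \<in> sets lebesgue"
  shows "X \<inter> {u..<v} \<in> lmeasurable"
proof -
  have "{u..<v} \<in> lmeasurable"
    by (rule bounded_set_imp_lmeasurable) auto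
  from fmeasurable_Int_fmeasurable[OF this assms] show ?thesis
    by (simp add: Int_commute)
qed

lemma amount_nonneg [simp]: "0 \<le> amount X u v"
  by (simp add: amount_def)

lemma amount_le:
  assumes "X \<in> sets lebesgue" "u \<le> v"
  shows "amount X u v \<le> v - u"
proof -
  have "measure lebesgue (X \<inter> {u..<v}) \<le> measure lebesgue {u..<v}"
    by (rule measure_mono_fmeasurable)
       (use assms lmeasurable_Int_Ico[of UNIV u v] in auto)
  then show ?thesis using assms by (simp add: amount_def)
qed

lemma amount_subset:
  assumes "X \<in> sets lebesgue" "Y \<in> sets lebesgue" "X \<inter> {u..<v} \<subseteq> Y \<inter> {u'..<v'}"
  shows "amount X u v \<le> amount Y u' v'"
  unfolding amount_def
  by (rule measure_mono_fmeasurable) (use assms lmeasurable_Int_Ico in \<open>auto intro!: sets.Int\<close>)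

lemma measure_split:
  assumes "A \<in> fmeasurable M" "Y \<in> sets M"
  shows "measure M A = measure M (A \<inter> Y) + measure M (A - Y)"
proof -
  have fm: "A \<inter> Y \<in> fmeasurable M" "A - Y \<in> fmeasurable M"
    using assms by (auto intro: fmeasurable_Int_fmeasurable fmeasurable_Diff)
  have "A = (A \<inter> Y) \<union> (A - Y)" "(A - Y) - (A \<inter> Y) = A - Y" by auto
  then show ?thesis using measure_Un2[OF fm] by simp
qed

lemma amount_split:
  assumes "X \<in> sets lebesgue" "u \<le> v" "v \<le> w"
  shows "amount X u w = amount X u v + amount X v w"
proof -
  have "X \<inter> {u..<w} \<inter> {..<v} = X \<inter> {u..<v}" "X \<inter> {u..<w} - {..<v} = X \<inter> {v..<w}"
    using assms by auto
  then show ?thesis unfolding amount_def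
    using measure_split[OF lmeasurable_Int_Ico[OF assms(1), of u w], of "{..<v}"] by simp
qed

text \<open>Lengthening the interval by \<open>d\<close> adds at most \<open>d\<close>, so the
  function is 1-Lipschitz. Continuity lets the intermediate value theorem find the instant at which
  a job completes.\<close>

lemma continuous_on_amount:
  assumes "X \<in> sets lebesgue"
  shows "continuous_on {u..} (amount X u)"
proof -
  have "\<bar>amount X u x - amount X u y\<bar> \<le> \<bar>x - y\<bar>" if "u \<le> x" "u \<le> y" for x y
    using amount_split[OF assms, of u x y] amount_split[OF assms, of u y x]
      amount_le[OF assms, of x y] amount_le[OF assms, of y x] that
      amount_nonneg[of X x y] amount_nonneg[of X y x]
    by (cases "x \<le> y") (auto simp: abs_le_iff)
  then have "1-lipschitz_on {u..} (amount X u)"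
    by (intro lipschitz_onI) (auto simp: dist_real_def)
  then show ?thesis by (rule lipschitz_on_continuous_on)
qed

text \<open>Integrate over \<open>F\<close> the number of sets \<open>E i\<close> containing a
  point. This turns a count of running tasks at each instant into a bound on their total
  work.\<close>

lemma sum_measure_ge:
  assumes "finite A" "\<And>i. i \<in> A \<Longrightarrow> E i \<in> sets M" "F \<in> fmeasurable M"
    and "\<And>s. s \<in> F \<Longrightarrow> m \<le> real (card {i \<in> A. s \<in> E i})"
  shows "m * measure M F \<le> (\<Sum>i\<in>A. measure M (E i \<inter> F))"
proof -
  have fm: "E i \<inter> F \<in> fmeasurable M" if "i \<in> A" for i
    using fmeasurable_Int_fmeasurable[OF assms(3) assms(2)[OF that]] by (simp add: Int_commute)
  have int: "integrable M (indicat_real (E i \<inter> F))" if "i \<in> A" for i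
    using fm[OF that] by (simp add: fmeasurable_def)
  have intF: "integrable M (indicat_real F)"
    using assms(3) by (simp add: fmeasurable_def)
  have le: "m * indicat_real F s \<le> (\<Sum>i\<in>A. indicat_real (E i \<inter> F) s)" for s
  proof (cases "s \<in> F")
    case True
    have "(\<Sum>i\<in>A. indicat_real (E i \<inter> F) s) = (\<Sum>i\<in>A. if s \<in> E i then 1 else 0)"
      by (rule sum.cong) (use True in \<open>auto simp: indicator_def\<close>)
    also have "\<dots> = real (card {i \<in> A. s \<in> E i})"
      using assms(1) by (simp add: sum.If_cases Int_def)
    finally show ?thesis using True assms(4) by simp
  qed (auto simp: indicator_def)
  have "m * measure M F = (LINT s|M. m * indicat_real F s)"
    using assms(3) sets.Int_space_eq2[of F M] fmeasurableD by simp
  also have "\<dots> \<le> (LINT s|M. (\<Sum>i\<in>A. indicat_real (E i \<inter> F) s))"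
    by (rule integral_mono) (use int intF le in auto)
  also have "\<dots> = (\<Sum>i\<in>A. LINT s|M. indicat_real (E i \<inter> F) s)"
    using int by (rule Bochner_Integration.integral_sum)
  also have "\<dots> = (\<Sum>i\<in>A. measure M (E i \<inter> F))"
    by (rule sum.cong) (use fm sets.Int_space_eq2 fmeasurableD in auto)
  finally show ?thesis .
qed

section \<open>Finite sets ranked by order or by value\<close>

text \<open>If some element of \<open>A\<close> is left out, the least one left out has at least
  \<open>m\<close> predecessors in \<open>A\<close>, none of them left out. When \<open>A\<close> is
  the set of active tasks, the elements kept are those that the scheduler runs.\<close>

lemma card_first_elements:
  fixes A :: "'a::wellorder set"
  assumes "finite A"
  shows "min m (card A) \<le> card {h \<in> A. card {g \<in> A. g < h} < m}" (is "_ \<le> card ?B")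
proof (cases "?B = A")
  case False
  then have "\<exists>h. h \<in> A - ?B" by auto
  then have h: "(LEAST h. h \<in> A - ?B) \<in> A - ?B" (is "?h \<in> _") by (rule LeastI_ex)
  have "{g \<in> A. g < ?h} \<subseteq> ?B"
    using not_less_Least[of _ "\<lambda>h. h \<in> A - ?B"] by blast
  then have "card {g \<in> A. g < ?h} \<le> card ?B"
    by (intro card_mono) (use assms in auto)
  then show ?thesis using h by auto
qed simp

text \<open>The elements of \<open>Z - X\<close> inject into \<open>X - Z\<close>, and none has a
  larger value than its image. This compares the actual carry-in tasks with the set chosen by the
  test.\<close>

lemma sum_le_sum_largest:
  fixes f :: "'a \<Rightarrow> real"
  assumes "finite X" "finite Z" "card Z \<le> card X"
    and "\<And>x. x \<in> X \<Longrightarrow> 0 \<le> f x"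
    and "\<And>x z. x \<in> X \<Longrightarrow> z \<in> Z - X \<Longrightarrow> f z \<le> f x"
  shows "sum f Z \<le> sum f X"
proof -
  have "card (Z - X) \<le> card (X - Z)"
    using assms(1-3) card_le_sym_Diff by blast
  then obtain g where g: "g ` (Z - X) \<subseteq> X - Z" "inj_on g (Z - X)"
    using card_le_inj[of "Z - X" "X - Z"] assms by auto
  have "sum f (Z - X) \<le> (\<Sum>z\<in>Z - X. f (g z))"
    by (rule sum_mono) (use g assms(5) in blast)
  also have "\<dots> = sum f (g ` (Z - X))"
    using g by (simp add: sum.reindex)
  also have "\<dots> \<le> sum f (X - Z)"
    by (rule sum_mono2) (use g assms in auto)
  finally have "sum f (Z - X) \<le> sum f (X - Z)" .
  then show ?thesis
    using sum.Int_Diff[of Z f X] sum.Int_Diff[of X f Z] assms(1,2) by (simp add: Int_commute)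
qed

section \<open>Arrivals, service and work in a fixed schedule\<close>

locale gfp_run =
  fixes M n :: nat and \<tau> :: "nat \<Rightarrow> task" and a c :: "nat \<Rightarrow> nat \<Rightarrow> real" and S :: schedule
  assumes valid: "\<And>i. i \<in> {1..n} \<Longrightarrow> valid_task (\<tau> i)"
    and arrivals: "legal_arrivals n \<tau> a"
    and costs: "legal_costs n \<tau> c"
    and gfp: "gfp_schedule M n a c S"
begin

abbreviation runs :: "nat \<Rightarrow> nat \<Rightarrow> real set" where
  "runs i j \<equiv> {t. executes M S i j t}"

definition busy :: "nat \<Rightarrow> real set" where
  "busy i = (\<Union>j. runs i j)"

abbreviation finished :: "nat \<Rightarrow> nat \<Rightarrow> real \<Rightarrow> bool" where
  "finished i j t \<equiv> c i j \<le> service M S i j t"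

abbreviation act :: "nat \<Rightarrow> real \<Rightarrow> bool" where
  "act \<equiv> active M a c S"

lemma runs_sets [measurable, simp]: "runs i j \<in> sets lebesgue"
  using gfp by (simp add: gfp_schedule_def)

lemma busy_sets [measurable, simp]: "busy i \<in> sets lebesgue"
  unfolding busy_def by (intro sets.countable_UN) auto

lemma runsD:
  assumes "t \<in> runs i j"
  shows "i \<in> {1..n}" "a i j \<le> t" "\<not> finished i j t" "\<And>r. r < j \<Longrightarrow> \<not> pending M a c S i r t"
proof -
  have "i \<in> {1..n} \<and> pending M a c S i j t \<and> (\<forall>j'<j. \<not> pending M a c S i j' t)"
    using assms gfp unfolding gfp_schedule_def by blast
  then show "i \<in> {1..n}" "a i j \<le> t" "\<not> finished i j t" "\<And>r. r < j \<Longrightarrow> \<not> pending M a c S i r t"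
    by (auto simp: pending_def)
qed

lemma busy_iff:
  assumes "i \<in> {1..n}" "act i t"
  shows "t \<in> busy i \<longleftrightarrow> card {h \<in> {1..<i}. act h t} < M"
  using assms gfp by (auto simp: gfp_schedule_def busy_def)

lemma params:
  assumes "i \<in> {1..n}"
  shows "0 < wcet (\<tau> i)" "0 < period (\<tau> i)" "0 < deadline (\<tau> i)" "0 < util (\<tau> i)"
    "util (\<tau> i) \<le> 1" "util (\<tau> i) * period (\<tau> i) = wcet (\<tau> i)"
  using valid[OF assms] by (auto simp: valid_task_def util_def)

lemma cost:
  assumes "i \<in> {1..n}"
  shows "0 \<le> c i j" "c i j \<le> wcet (\<tau> i)"
  using costs assms by (auto simp: legal_costs_def)

lemma arrival_gap:
  assumes "i \<in> {1..n}"
  shows "a i r + real m * period (\<tau> i) \<le> a i (r + m)"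
proof (induction m)
  case (Suc m)
  have "a i (r + m) + period (\<tau> i) \<le> a i (Suc (r + m))"
    using arrivals assms unfolding legal_arrivals_def by blast
  then show ?case using Suc by (simp add: algebra_simps)
qed simp

lemma arrival_mono:
  assumes "i \<in> {1..n}" "r \<le> j"
  shows "a i r \<le> a i j"
proof -
  obtain m where "j = r + m" using assms(2) le_Suc_ex by blast
  moreover have "0 \<le> real m * period (\<tau> i)" using params[OF assms(1)] by simp
  ultimately show ?thesis using arrival_gap[OF assms(1), of r m] by simp
qed

lemma arrivals_unbounded:
  assumes "i \<in> {1..n}"
  shows "\<exists>j. t \<le> a i j"
proof -
  obtain m :: nat where m: "t - a i 0 \<le> real m * period (\<tau> i)"
    using reals_Archimedean3[OF params(2)[OF assms]] less_le by blast
  then show ?thesis using arrival_gap[OF assms, of 0 m] by (intro exI[of _ m]) simp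
qed

text \<open>A job never runs before its arrival, so the half-line in \<open>service\<close> may be
  cut off at any \<open>u\<close> up to there.\<close>

lemma service_eq_amount:
  assumes "u \<le> a i j"
  shows "service M S i j t = amount (runs i j) u t"
proof -
  have "{s. s < t \<and> executes M S i j s} = runs i j \<inter> {u..<t}"
    using runsD(2)[of _ i j] assms by force
  then show ?thesis by (simp add: service_def amount_def)
qed

lemma service_mono:
  assumes "s \<le> t"
  shows "service M S i j s \<le> service M S i j t"
  unfolding service_eq_amount[OF order_refl] by (rule amount_subset) (use assms in auto)

text \<open>A job runs only while unfinished. Were its service to exceed \<open>c i j\<close>, by
  continuity it would equal \<open>c i j\<close> at some earlier instant, from which on the job no
  longer runs.\<close>

lemma service_le_cost:
  assumes "i \<in> {1..n}"
  shows "service M S i j t \<le> c i j"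
proof (rule ccontr)
  assume neg: "\<not> ?thesis"
  let ?F = "amount (runs i j) (a i j)"
  have F: "service M S i j s = ?F s" for s by (rule service_eq_amount) simp
  have F0: "?F (a i j) = 0" by (simp add: amount_def)
  have "a i j \<le> t"
  proof (rule ccontr)
    assume "\<not> a i j \<le> t"
    then have "?F t = 0" by (simp add: amount_def)
    then show False using neg F cost(1)[OF assms, of j] by simp
  qed
  moreover have "continuous_on {a i j..t} ?F"
    by (rule continuous_on_subset[OF continuous_on_amount]) auto
  ultimately obtain s where s: "a i j \<le> s" "s \<le> t" "?F s = c i j"
    using IVT'[of ?F "a i j" "c i j" t] F0 cost(1)[OF assms, of j] neg F by auto
  have "runs i j \<inter> {s..<t} = {}"
    using runsD(3)[of _ i j] service_mono[of s _ i j] s(3) F by fastforce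
  then have "?F t = ?F s"
    using amount_split[of "runs i j" "a i j" s t] s by (simp add: amount_def)
  then show False using neg F s by simp
qed

lemma service_le_time:
  "service M S i j t \<le> max 0 (t - a i j)"
proof (cases "a i j \<le> t")
  case True
  then show ?thesis unfolding service_eq_amount[OF order_refl]
    using amount_le[of "runs i j" "a i j" t] by simp
qed (simp add: service_eq_amount[OF order_refl] amount_def)

lemma work_le_service:
  assumes "finite J" "busy i \<inter> {u..<v} \<subseteq> (\<Union>j\<in>J. runs i j)"
  shows "amount (busy i) u v \<le> (\<Sum>j\<in>J. service M S i j v)"
proof -
  \<comment> \<open>The half-line itself has infinite measure; the arrival of the job bounds the set
    from the left.\<close>
  have fm: "runs i j \<inter> {..<v} \<in> lmeasurable" for j
  proof -
    have "runs i j \<inter> {..<v} = runs i j \<inter> {a i j..<v}" using runsD(2)[of _ i j] by force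
    then show ?thesis by (simp only: lmeasurable_Int_Ico[OF runs_sets])
  qed
  have "amount (busy i) u v \<le> measure lebesgue (\<Union>j\<in>J. runs i j \<inter> {..<v})"
    unfolding amount_def
  proof (rule measure_mono_fmeasurable)
    show "(\<Union>j\<in>J. runs i j \<inter> {..<v}) \<in> lmeasurable"
      using assms fm by (intro fmeasurable.finite_UN) auto
  qed (use assms in \<open>auto intro!: sets.Int\<close>)
  also have "\<dots> \<le> (\<Sum>j\<in>J. measure lebesgue (runs i j \<inter> {..<v}))"
    by (rule measure_UNION_le) (use assms fm in auto)
  also have "\<dots> = (\<Sum>j\<in>J. service M S i j v)"
    by (simp add: service_def Int_def conj_commute)
  finally show ?thesis .
qed

text \<open>
  Instead of the arrival \<open>a i q\<close> of the first unfinished job, any earlier \<open>b\<close> may start the window;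
  for a task without carry-in, this is the start \<open>u\<close> of the interval itself.
\<close>

lemma work_bound:
  assumes i: "i \<in> {1..n}" and fin: "\<And>r. r < q \<Longrightarrow> finished i r u"
    and b: "b \<le> a i q" "b \<le> v"
  shows "amount (busy i) u v
    \<le> wcet (\<tau> i) - wcet (\<tau> i) * util (\<tau> i) + util (\<tau> i) * (v - b)"
proof -
  let ?C = "wcet (\<tau> i)" and ?T = "period (\<tau> i)" and ?U = "util (\<tau> i)"
  note p = params[OF i]
  \<comment> \<open>\<open>m\<close> counts the whole periods in the window and \<open>x\<close> is
    the remainder. Of the jobs from \<open>q\<close> on, only \<open>q\<close> to
    \<open>q + m\<close> can arrive by \<open>v\<close>.\<close>
  define m where "m = nat \<lfloor>(v - b) / ?T\<rfloor>"
  define x where "x = v - b - real m * ?T"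
  have m: "real m = of_int \<lfloor>(v - b) / ?T\<rfloor>" unfolding m_def using b p by simp
  have "real m \<le> (v - b) / ?T" "(v - b) / ?T < real m + 1" unfolding m by linarith+
  then have x0: "0 \<le> x" "x < ?T" using p by (auto simp: x_def field_simps)
  have "busy i \<inter> {u..<v} \<subseteq> (\<Union>j\<in>{q..q + m}. runs i j)"
  proof
    fix s assume s: "s \<in> busy i \<inter> {u..<v}"
    then obtain j where j: "s \<in> runs i j" by (auto simp: busy_def)
    have "\<not> j < q"
      using fin[of j] service_mono[of u s i j] s runsD(3)[OF j] by auto
    moreover have "\<not> q + m < j"
    proof
      assume "q + m < j"
      then have "a i (q + Suc m) \<le> a i j" using arrival_mono[OF i] by simp
      then have "a i q + real (Suc m) * ?T \<le> s"
        using arrival_gap[OF i, of q "Suc m"] runsD(2)[OF j] by linarith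
      then show False using s b x0 by (simp add: x_def algebra_simps)
    qed
    ultimately show "s \<in> (\<Union>j\<in>{q..q + m}. runs i j)" using j by auto
  qed
  then have "amount (busy i) u v \<le> (\<Sum>j\<in>{q..q + m}. service M S i j v)"
    by (intro work_le_service) auto
  also have "\<dots> = (\<Sum>j\<in>{q..<q + m}. service M S i j v) + service M S i (q + m) v"
    by (simp add: atLeastLessThanSuc_atLeastAtMost[symmetric])
  also have "(\<Sum>j\<in>{q..<q + m}. service M S i j v) \<le> (\<Sum>j\<in>{q..<q + m}. ?C)"
    by (intro sum_mono) (meson cost(2) i order_trans service_le_cost)
  also have "(\<Sum>j\<in>{q..<q + m}. ?C) = ?U * (real m * ?T)" using p(6) by simp
  also have "service M S i (q + m) v \<le> ?C - ?C * ?U + ?U * x"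
  proof -
    have 1: "service M S i (q + m) v \<le> ?C"
      by (meson cost(2) i order_trans service_le_cost)
    have 2: "service M S i (q + m) v \<le> x"
      using service_le_time[of i "q + m" v] arrival_gap[OF i, of q m] b x0 by (simp add: x_def)
    \<comment> \<open>The share \<open>1 - ?U\<close> of the minimum is bounded by the cost, the
      share \<open>?U\<close> by the time \<open>x\<close>. This produces the term
      \<open>?C - ?C * ?U\<close>.\<close>
    have "min ?C x = (1 - ?U) * min ?C x + ?U * min ?C x" by (simp add: algebra_simps)
    also have "\<dots> \<le> (1 - ?U) * ?C + ?U * x"
      by (intro add_mono mult_left_mono) (use p in auto)
    finally show ?thesis using 1 2 by (simp add: algebra_simps)
  qed
  finally show ?thesis by (simp add: x_def algebra_simps)
qed

section \<open>Saturated processors and higher-priority load\<close>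

text \<open>All tasks of higher priority than some \<open>h < i\<close> lie below \<open>i\<close>
  as well, so the rank of \<open>h\<close> among the active tasks below \<open>i\<close> decides
  whether it runs.\<close>

lemma card_busy_ge:
  assumes "i \<le> Suc n"
  shows "min M (card {h \<in> {1..<i}. act h t}) \<le> card {h \<in> {1..<i}. t \<in> busy h}"
proof -
  let ?A = "{h \<in> {1..<i}. act h t}"
  have "{h \<in> ?A. card {g \<in> ?A. g < h} < M} \<subseteq> {h \<in> {1..<i}. t \<in> busy h}"
  proof
    fix h assume h: "h \<in> {h \<in> ?A. card {g \<in> ?A. g < h} < M}"
    then have "{g \<in> ?A. g < h} = {g \<in> {1..<h}. act g t}" by auto
    then show "h \<in> {h \<in> {1..<i}. t \<in> busy h}"
      using h busy_iff[of h t] assms by auto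
  qed
  then have "card {h \<in> ?A. card {g \<in> ?A. g < h} < M} \<le> card {h \<in> {1..<i}. t \<in> busy h}"
    by (intro card_mono) auto
  then show ?thesis using card_first_elements[of ?A M] by simp
qed

text \<open>An active task waits only if at least \<open>M\<close> active tasks have higher
  priority, and then at least \<open>M\<close> of these run.\<close>

lemma waiting_imp_saturated:
  assumes "i \<in> {1..n}" "act i t" "t \<notin> busy i" "i \<le> k"
  shows "M \<le> card {h \<in> {1..<k}. t \<in> busy h}"
proof -
  have "M \<le> card {h \<in> {1..<i}. t \<in> busy h}"
    using busy_iff[of i t] card_busy_ge[of i t] assms by auto
  also have "\<dots> \<le> card {h \<in> {1..<k}. t \<in> busy h}"
    by (intro card_mono) (use assms in auto)
  finally show ?thesis .
qed

definition load :: "nat \<Rightarrow> real \<Rightarrow> real \<Rightarrow> real" where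
  "load k u v = (\<Sum>h\<in>{1..<k}. amount (busy h) u v)"

lemma load_nonneg [simp]: "0 \<le> load k u v"
  unfolding load_def by (intro sum_nonneg) simp

lemma load_split:
  assumes "u \<le> v" "v \<le> w"
  shows "load k u w = load k u v + load k v w"
  unfolding load_def using amount_split[OF busy_sets assms] by (simp add: sum.distrib)

text \<open>No task runs before its first arrival, which makes the bound independent of
  \<open>u\<close>. Hence the window cannot be extended to the left indefinitely.\<close>

lemma load_bounded:
  shows "load k u v \<le> (\<Sum>h\<in>{1..<k}. max 0 (v - a h 0))"
  unfolding load_def
proof (rule sum_mono)
  fix h
  have "a h 0 \<le> s" if s: "s \<in> busy h" for s
  proof -
    obtain j where "s \<in> runs h j" using s by (auto simp: busy_def)
    then show ?thesis using runsD(1,2)[of s h j] arrival_mono[of h 0 j] by force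
  qed
  then have "amount (busy h) u v \<le> amount (busy h) (a h 0) (max (a h 0) v)"
    by (intro amount_subset) auto
  also have "\<dots> \<le> max 0 (v - a h 0)"
    using amount_le[of "busy h" "a h 0" "max (a h 0) v"] by simp
  finally show "amount (busy h) u v \<le> max 0 (v - a h 0)" .
qed

lemma load_ge_of_card:
  assumes "u \<le> v" "\<And>s. s \<in> {u..<v} \<Longrightarrow> m \<le> real (card {h \<in> {1..<k}. s \<in> busy h})"
  shows "m * (v - u) \<le> load k u v"
  using sum_measure_ge[of "{1..<k}" busy lebesgue "{u..<v}" m] assms lmeasurable_Int_Ico[of UNIV u v]
  by (auto simp: load_def amount_def)

text \<open>Split the interval into the time when task \<open>i\<close> runs and the time when it
  waits. While it waits, at least \<open>M\<close> tasks of higher priority run; while it runs, it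
  contributes to the load itself if \<open>i < k\<close>.\<close>

lemma load_ge_of_act:
  assumes i: "i \<in> {1..n}" "i \<le> k" and uv: "u \<le> v" and act: "\<And>s. s \<in> {u..<v} \<Longrightarrow> act i s"
  shows "real M * (v - u - amount (busy i) u v) + (if i < k then amount (busy i) u v else 0)
    \<le> load k u v"
proof -
  let ?I = "busy i \<inter> {u..<v}" and ?W = "{u..<v} - busy i"
  have W: "?W \<in> lmeasurable"
    using lmeasurable_Int_Ico[of "- busy i" u v] by (simp add: Diff_eq Int_commute Compl_in_sets_lebesgue)
  have I: "?I \<in> lmeasurable" by (rule lmeasurable_Int_Ico) simp
  have split: "measure lebesgue (X \<inter> {u..<v}) = measure lebesgue (X \<inter> ?I) + measure lebesgue (X \<inter> ?W)"
    if "X \<in> sets lebesgue" for X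
  proof -
    have "X \<inter> {u..<v} \<inter> busy i = X \<inter> ?I" "X \<inter> {u..<v} - busy i = X \<inter> ?W" by auto
    then show ?thesis
      using measure_split[OF lmeasurable_Int_Ico[OF that, of u v], of "busy i"] by simp
  qed
  have "real M * measure lebesgue ?W \<le> (\<Sum>h\<in>{1..<k}. measure lebesgue (busy h \<inter> ?W))"
    by (rule sum_measure_ge) (use W waiting_imp_saturated[OF i(1)] act i in auto)
  moreover have "(if i < k then 1 else 0) * measure lebesgue ?I
      \<le> (\<Sum>h\<in>{1..<k}. measure lebesgue (busy h \<inter> ?I))"
  proof (rule sum_measure_ge)
    fix s assume "s \<in> ?I"
    then have "card (if i < k then {i} else {}) \<le> card {h \<in> {1..<k}. s \<in> busy h}"
      by (intro card_mono) (use i in auto)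
    then show "(if i < k then 1 else 0) \<le> real (card {h \<in> {1..<k}. s \<in> busy h})"
      by (auto split: if_splits)
  qed (use I in auto)
  moreover have "load k u v = (\<Sum>h\<in>{1..<k}. measure lebesgue (busy h \<inter> ?I))
      + (\<Sum>h\<in>{1..<k}. measure lebesgue (busy h \<inter> ?W))"
    unfolding load_def amount_def using split by (simp add: sum.distrib)
  moreover have "measure lebesgue ?W = v - u - amount (busy i) u v"
    using split[of UNIV] uv by (simp add: amount_def)
  ultimately show ?thesis by (auto simp: amount_def split: if_splits)
qed

section \<open>Busy periods and the extended window\<close>

lemma unfinished_imp_act:
  assumes "\<not> finished i j t" "s \<in> {a i j..t}"
  shows "act i s"
  using assms service_mono[of s t i j] by (force simp: active_def pending_def)

text \<open>Take the least \<open>q\<close> from whose arrival on the task stays active up to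
  \<open>t\<close>. An earlier job still unfinished at that arrival would have the same
  property.\<close>

lemma busy_period_start:
  assumes i: "i \<in> {1..n}" and j: "\<not> finished i j t"
  obtains q where "q \<le> j" "\<And>s. s \<in> {a i q..t} \<Longrightarrow> act i s" "\<And>r. r < q \<Longrightarrow> finished i r (a i q)"
proof -
  let ?P = "\<lambda>q. \<forall>s\<in>{a i q..t}. act i s"
  have Pj: "?P j" using unfinished_imp_act[OF j] by blast
  define q where "q = (LEAST q. ?P q)"
  have q: "?P q" "q \<le> j" unfolding q_def by (rule LeastI[of ?P, OF Pj], rule Least_le[of ?P, OF Pj])
  have "finished i r (a i q)" if "r < q" for r
  proof (rule ccontr)
    assume "\<not> finished i r (a i q)"
    then have "act i s" if "s \<in> {a i r..a i q}" for s
      using unfinished_imp_act that by blast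
    then have "?P r" using q(1) by (meson atLeastAtMost_iff linear)
    then show False using that not_less_Least unfolding q_def by blast
  qed
  then show ?thesis using that q by blast
qed

text \<open>
  The point \<open>t\<close> is the infimum of all admissible ones. It is admissible itself since \<open>load\<close> only
  grows to the left, and the strict hypothesis leaves room for \<open>t < t0\<close>.
\<close>

lemma window_extension:
  assumes "0 < \<mu>" "t0 \<le> v" "\<mu> * (v - t0) < load k t0 v + B"
  obtains t where "t < t0" "\<mu> * (v - t) \<le> load k t v + B"
    "\<And>u. u < t \<Longrightarrow> load k u t < \<mu> * (t - u)"
proof -
  define P where "P = {t. t \<le> t0 \<and> \<mu> * (v - t) \<le> load k t v + B}"
  define t where "t = Inf P"
  have antimono: "load k u v \<le> load k s v" if "s \<le> u" "u \<le> v" for s u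
    using load_split[OF that, of k] load_nonneg[of k s u] by simp
  \<comment> \<open>Moving \<open>t0\<close> left by the slack divided by \<open>\<mu>\<close> uses
    up the slack exactly.\<close>
  define t1 where "t1 = t0 - (load k t0 v + B - \<mu> * (v - t0)) / \<mu>"
  have t1: "t1 < t0" "\<mu> * (v - t1) = load k t0 v + B"
    using assms by (auto simp: t1_def field_simps)
  then have "t1 \<in> P" using antimono[of t1 t0] assms by (auto simp: P_def)
  have "bdd_below P"
  proof
    fix s assume "s \<in> P"
    then have "\<mu> * (v - s) \<le> (\<Sum>h\<in>{1..<k}. max 0 (v - a h 0)) + B"
      using load_bounded[of k s v] by (auto simp: P_def)
    then show "v - ((\<Sum>h\<in>{1..<k}. max 0 (v - a h 0)) + B) / \<mu> \<le> s"
      using assms by (simp add: field_simps)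
  qed
  then have lower: "t \<le> s" if "s \<in> P" for s
    unfolding t_def using that by (intro cInf_lower)
  have "t \<le> t1" using lower \<open>t1 \<in> P\<close> .
  have t: "\<mu> * (v - t) \<le> load k t v + B"
  proof (rule field_le_epsilon)
    fix e :: real assume "0 < e"
    then have "\<exists>s\<in>P. s < t + e / \<mu>"
      using \<open>t1 \<in> P\<close> assms \<open>bdd_below P\<close> cInf_less_iff[of P "t + e / \<mu>"] by (auto simp: t_def)
    then obtain s where s: "s \<in> P" "s < t + e / \<mu>" by blast
    have "t \<le> s" using lower s by simp
    moreover have "\<mu> * (s - t) \<le> e" using s assms by (simp add: field_simps)
    ultimately show "\<mu> * (v - t) \<le> load k t v + B + e"
      using antimono[of t s] s assms by (simp add: P_def algebra_simps)
  qed
  show ?thesis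
  proof (rule that)
    fix u assume "u < t"
    \<comment> \<open>Points left of the infimum are not admissible. Subtracting the inequality for
      \<open>t\<close> then removes \<open>B\<close> and the load after \<open>t\<close>.\<close>
    then have "load k u v + B < \<mu> * (v - u)"
      using lower[of u] \<open>u < t\<close> \<open>t \<le> t1\<close> t1 by (force simp: P_def)
    moreover have "load k u v = load k u t + load k t v"
      using load_split[of u t v k] \<open>u < t\<close> \<open>t \<le> t1\<close> t1 assms by simp
    ultimately show "load k u t < \<mu> * (t - u)"
      using t by (simp add: algebra_simps)
  qed (use t t1 \<open>t \<le> t1\<close> in auto)
qed

section \<open>Carry-in at the start of the extended window\<close>

text \<open>The arrival lies strictly before \<open>t\<close>: a job arriving at \<open>t\<close>
  belongs to the window.\<close>

definition carry_in :: "nat \<Rightarrow> real \<Rightarrow> bool" where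
  "carry_in i t \<longleftrightarrow> (\<exists>j. a i j < t \<and> \<not> finished i j t)"

text \<open>Pick an unfinished job of each carry-in task. From the latest of their arrivals
  \<open>u\<close> up to \<open>t\<close> all these tasks are active; if there were at least
  \<open>\<mu>\<close> of them, at least \<open>\<mu>\<close> tasks would run throughout,
  contradicting \<open>below\<close> at \<open>u\<close>.\<close>

lemma card_carry_in_less:
  assumes "k \<le> Suc n" "0 < \<mu>" "\<mu> \<le> real M"
    and below: "\<And>u. u < t \<Longrightarrow> load k u t < \<mu> * (t - u)"
  shows "real (card {i \<in> {1..<k}. carry_in i t}) < \<mu>"
proof (rule ccontr)
  let ?Z = "{i \<in> {1..<k}. carry_in i t}"
  assume neg: "\<not> ?thesis"
  then have ne: "?Z \<noteq> {}" using assms(2) by (metis card.empty of_nat_0)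
  have "\<forall>i\<in>?Z. \<exists>j. a i j < t \<and> \<not> finished i j t" by (auto simp: carry_in_def)
  then obtain f where f: "\<And>i. i \<in> ?Z \<Longrightarrow> a i (f i) < t \<and> \<not> finished i (f i) t" by metis
  define u where "u = Max ((\<lambda>i. a i (f i)) ` ?Z)"
  have "u \<in> (\<lambda>i. a i (f i)) ` ?Z" unfolding u_def by (rule Max_in) (use ne in auto)
  then have "u < t" using f by auto
  have u: "a i (f i) \<le> u" if "i \<in> ?Z" for i unfolding u_def using that by auto
  have "\<mu> * (t - u) \<le> load k u t"
  proof (rule load_ge_of_card)
    fix s assume s: "s \<in> {u..<t}"
    have "act i s" if "i \<in> ?Z" for i
      by (rule unfinished_imp_act[of i "f i" t]) (use f[OF that] u[OF that] s in auto)
    then have "card ?Z \<le> card {h \<in> {1..<k}. act h s}" by (intro card_mono) auto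
    then have "min M (card ?Z) \<le> card {h \<in> {1..<k}. s \<in> busy h}"
      using card_busy_ge[OF assms(1), of s] by linarith
    then show "\<mu> \<le> real (card {h \<in> {1..<k}. s \<in> busy h})" using neg assms(3) by linarith
  qed (use \<open>u < t\<close> in simp)
  then show False using below[OF \<open>u < t\<close>] by simp
qed

text \<open>The cases differ in the start used in \<open>work_bound\<close>: \<open>t\<close> itself
  without carry-in, the arrival of the first unfinished job if the utilization exceeds
  \<open>\<rho>\<close>, and otherwise the start of the busy period, where the work done before
  \<open>t\<close> is subtracted again.\<close>

lemma higher_priority_work:
  assumes "2 \<le> M" "i \<in> {1..<k}" "k \<le> n" "t \<le> v"
    and deadlines: "\<And>j. finished i j (a i j + deadline (\<tau> i))"
    and below: "\<And>u. u < t \<Longrightarrow> load k u t < mu M \<rho> * (t - u)"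
  shows "amount (busy i) t v
    \<le> wcet (\<tau> i) - wcet (\<tau> i) * util (\<tau> i) + util (\<tau> i) * (v - t)
      + (if carry_in i t \<and> util (\<tau> i) > \<rho> then util (\<tau> i) * deadline (\<tau> i) else 0)"
    (is "_ \<le> ?base + ?U * (v - t) + _")
proof -
  have i: "i \<in> {1..n}" using assms by auto
  note p = params[OF i]
  consider "\<not> carry_in i t" | "carry_in i t" "?U > \<rho>" | "carry_in i t" "?U \<le> \<rho>" by linarith
  then show ?thesis
  proof cases
    case 1
    define q where "q = (LEAST j. t \<le> a i j)"
    have "t \<le> a i q" unfolding q_def by (rule LeastI_ex[OF arrivals_unbounded[OF i]])
    moreover have "finished i r t" if "r < q" for r
      using not_less_Least[OF that[unfolded q_def]] 1 by (auto simp: carry_in_def)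
    ultimately show ?thesis using work_bound[OF i, of q t t v] 1 assms by simp
  next
    case 2
    then obtain j where j: "a i j < t" "\<not> finished i j t" by (auto simp: carry_in_def)
    define q where "q = (LEAST j. \<not> finished i j t)"
    have q: "\<not> finished i q t" "q \<le> j"
      unfolding q_def using j(2) by (rule LeastI, rule Least_le)
    have "finished i r t" if "r < q" for r using not_less_Least[OF that[unfolded q_def]] by simp
    moreover have "a i q < t" using arrival_mono[OF i q(2)] j by simp
    ultimately have "amount (busy i) t v \<le> ?base + ?U * (v - a i q)"
      using work_bound[OF i, of q t "a i q" v] assms by simp
    \<comment> \<open>Job \<open>q\<close> meets its deadline but is unfinished at \<open>t\<close>,
      so its deadline is not before \<open>t\<close>.\<close>
    moreover have "t \<le> a i q + deadline (\<tau> i)"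
      using q(1) deadlines[of q] service_mono[of "a i q + deadline (\<tau> i)" t i q] by linarith
    then have "?U * (v - a i q) \<le> ?U * (v - t + deadline (\<tau> i))"
      using p by (intro mult_left_mono) auto
    ultimately show ?thesis using 2 by (simp add: algebra_simps)
  next
    case 3
    then obtain j where j: "a i j < t" "\<not> finished i j t" by (auto simp: carry_in_def)
    obtain q where q: "q \<le> j" "\<And>s. s \<in> {a i q..t} \<Longrightarrow> act i s"
      "\<And>r. r < q \<Longrightarrow> finished i r (a i q)"
      using busy_period_start[OF i j(2)] by blast
    have qt: "a i q < t" using arrival_mono[OF i q(1)] j by simp
    let ?y = "amount (busy i) (a i q) t"
    have "real M * (t - a i q - ?y) + ?y \<le> load k (a i q) t"
      using load_ge_of_act[OF i, of k "a i q" t] q(2) qt assms(2) by simp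
    \<comment> \<open>The load is at least \<open>real M * (t - a i q) - (real M - 1) * ?y\<close>
      and less than \<open>mu M \<rho> * (t - a i q)\<close>; the multiples of \<open>M\<close>
      cancel.\<close>
    then have "(real M - 1) * (\<rho> * (t - a i q)) \<le> (real M - 1) * ?y"
      using below[OF qt] by (simp add: mu_def algebra_simps)
    then have "\<rho> * (t - a i q) \<le> ?y" using assms(1) by simp
    moreover have "?U * (t - a i q) \<le> \<rho> * (t - a i q)"
      using 3 qt by (intro mult_right_mono) auto
    moreover have "amount (busy i) (a i q) v \<le> ?base + ?U * (v - a i q)"
      using work_bound[OF i, of q "a i q" "a i q" v] q(3) qt assms(4) by simp
    moreover have "amount (busy i) (a i q) v = ?y + amount (busy i) t v"
      using amount_split[of "busy i" "a i q" t v] qt assms(4) by simp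
    ultimately show ?thesis using 3 by (simp add: algebra_simps)
  qed
qed

section \<open>Contradiction between a deadline miss and the test\<close>

text \<open>Only the jobs \<open>q\<close> to \<open>j\<close> run here: earlier ones are finished,
  and later ones would have to wait for \<open>j\<close>. The bound is strict because
  \<open>j\<close> is unfinished at \<open>v\<close>.\<close>

lemma deadline_miss_own_work:
  assumes k: "k \<in> {1..n}" and "q \<le> j"
    and prev: "\<And>r. r < q \<Longrightarrow> finished k r (a k q)"
    and miss: "\<not> finished k j v"
  shows "amount (busy k) (a k q) v < real (Suc (j - q)) * wcet (\<tau> k)"
proof -
  have "busy k \<inter> {a k q..<v} \<subseteq> (\<Union>r\<in>{q..j}. runs k r)"
  proof
    fix s assume s: "s \<in> busy k \<inter> {a k q..<v}"
    then obtain r where r: "s \<in> runs k r" by (auto simp: busy_def)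
    have "\<not> r < q"
      using prev[of r] service_mono[of "a k q" s k r] s runsD(3)[OF r] by auto
    moreover have "\<not> j < r"
    proof
      assume "j < r"
      then have "\<not> pending M a c S k j s" using runsD(4)[OF r] by blast
      moreover have "a k j \<le> s" using arrival_mono[OF k, of j r] \<open>j < r\<close> runsD(2)[OF r] by simp
      moreover have "service M S k j s < c k j"
        using miss service_mono[of s v k j] s by auto
      ultimately show False by (simp add: pending_def)
    qed
    ultimately show "s \<in> (\<Union>r\<in>{q..j}. runs k r)" using r by auto
  qed
  then have "amount (busy k) (a k q) v \<le> (\<Sum>r\<in>{q..j}. service M S k r v)"
    by (intro work_le_service) auto
  also have "\<dots> < (\<Sum>r\<in>{q..j}. wcet (\<tau> k))"
  proof (rule sum_strict_mono_ex1)
    show "\<forall>r\<in>{q..j}. service M S k r v \<le> wcet (\<tau> k)"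
      by (meson cost(2) k order_trans service_le_cost)
    show "\<exists>r\<in>{q..j}. service M S k r v < wcet (\<tau> k)"
      using miss cost(2)[OF k, of j] \<open>q \<le> j\<close> by (intro bexI[of _ j]) auto
  qed simp
  finally show ?thesis using \<open>q \<le> j\<close> by (simp add: Suc_diff_le)
qed

text \<open>Job \<open>q\<close> opens the busy period in which \<open>j\<close> misses its
  deadline, so the test is refuted for the number of jobs from \<open>q\<close> to
  \<open>j\<close>.\<close>

lemma deadline_miss_imp_not_test:
  assumes "2 \<le> M" and k: "k \<in> {1..n}" and "q \<le> j"
    and deadlines: "\<And>i j. i \<in> {1..<k} \<Longrightarrow> finished i j (a i j + deadline (\<tau> i))"
    and prev: "\<And>r. r < q \<Longrightarrow> finished k r (a k q)"
    and act: "\<And>s. s \<in> {a k q..a k j + deadline (\<tau> k)} \<Longrightarrow> act k s"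
    and miss: "\<not> finished k j (a k j + deadline (\<tau> k))"
  shows "\<not> test_condition M \<tau> k (Suc (j - q))"
proof
  define l where "l = Suc (j - q)"
  define v where "v = a k j + deadline (\<tau> k)"
  define D where "D = window \<tau> k l"
  define B where "B = real l * wcet (\<tau> k)"
  note p = params[OF k]
  assume "test_condition M \<tau> k (Suc (j - q))"
  then obtain \<rho> X where \<rho>: "\<rho> \<le> 1" "B / D \<le> \<rho>" and X: "carry_approx M \<tau> k \<rho> X"
    and test: "B / D + (\<Sum>i\<in>X. gamma \<tau> \<rho> i * util (\<tau> i) * deadline (\<tau> i) / D)
        + (\<Sum>i\<in>{1..<k}. (wcet (\<tau> i) - wcet (\<tau> i) * util (\<tau> i)) / D + util (\<tau> i)) \<le> mu M \<rho>"
    unfolding test_condition_def B_def D_def l_def by blast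
  let ?\<mu> = "mu M \<rho>"
  have "0 < D" using p by (simp add: D_def window_def l_def add_nonneg_pos)
  have "0 < B" using p by (simp add: B_def l_def)
  \<comment> \<open>The arrivals of the \<open>l\<close> jobs from \<open>q\<close> to
    \<open>j\<close> span at least \<open>l - 1\<close> periods.\<close>
  have "D \<le> v - a k q"
    using arrival_gap[OF k, of q "j - q"] \<open>q \<le> j\<close> by (simp add: D_def v_def window_def l_def)
  have "0 < \<rho>" using \<rho>(2) \<open>0 < B\<close> \<open>0 < D\<close> by (meson divide_pos_pos less_le_trans)
  have "0 < ?\<mu>" "?\<mu> \<le> real M"
  proof -
    have "(real M - 1) * \<rho> \<le> real M - 1" using \<rho>(1) assms(1) by (intro mult_left_le) auto
    then show "0 < ?\<mu>" by (simp add: mu_def)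
    show "?\<mu> \<le> real M" using \<open>0 < \<rho>\<close> assms(1) by (simp add: mu_def)
  qed
  \<comment> \<open>Task \<open>k\<close> runs for less than \<open>B\<close>, so the load exceeds
    \<open>real M * (v - a k q - B)\<close>. Adding \<open>B\<close> leaves a loss of
    \<open>(real M - 1) * B\<close>, which \<open>B \<le> \<rho> * (v - a k q)\<close> absorbs into
    \<open>?\<mu>\<close>.\<close>
  have "?\<mu> * (v - a k q) < load k (a k q) v + B"
  proof -
    let ?x = "amount (busy k) (a k q) v"
    have x: "?x < B"
      unfolding B_def l_def
      by (rule deadline_miss_own_work) (use k \<open>q \<le> j\<close> prev miss in \<open>auto simp: v_def\<close>)
    have "real M * (v - a k q - ?x) \<le> load k (a k q) v"
      using load_ge_of_act[OF k, of k "a k q" v] act \<open>D \<le> v - a k q\<close> \<open>0 < D\<close> by (simp add: v_def)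
    moreover have "B \<le> \<rho> * (v - a k q)"
    proof -
      have "B \<le> \<rho> * D" using \<rho>(2) \<open>0 < D\<close> by (simp add: field_simps)
      also have "\<dots> \<le> \<rho> * (v - a k q)" using \<open>D \<le> v - a k q\<close> \<open>0 < \<rho>\<close> by (intro mult_left_mono) auto
      finally show ?thesis .
    qed
    then have "(real M - 1) * B \<le> (real M - 1) * (\<rho> * (v - a k q))"
      using assms(1) by (intro mult_left_mono) auto
    moreover have "real M * ?x < real M * B" using x assms(1) by simp
    ultimately show ?thesis by (simp add: mu_def algebra_simps)
  qed
  then obtain t where t: "t < a k q" "?\<mu> * (v - t) \<le> load k t v + B"
    and below: "\<And>u. u < t \<Longrightarrow> load k u t < ?\<mu> * (t - u)"
    using window_extension[OF \<open>0 < ?\<mu>\<close>, of "a k q" v k B] \<open>D \<le> v - a k q\<close> \<open>0 < D\<close> by auto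
  define L where "L = v - t"
  have "D < L" using t \<open>D \<le> v - a k q\<close> by (simp add: L_def)

  define f where "f i = gamma \<tau> \<rho> i * util (\<tau> i) * deadline (\<tau> i)" for i
  define Y where "Y = (\<Sum>i\<in>{1..<k}. wcet (\<tau> i) - wcet (\<tau> i) * util (\<tau> i))"
  define V where "V = (\<Sum>i\<in>{1..<k}. util (\<tau> i))"
  let ?H = "{i \<in> {1..<k}. util (\<tau> i) > \<rho>}" and ?Z = "{i \<in> {1..<k}. carry_in i t \<and> util (\<tau> i) > \<rho>}"
  have f0: "0 \<le> f i" if "i \<in> {1..<k}" for i
    using params[of i] that k by (simp add: f_def gamma_def)
  have XH: "X \<subseteq> ?H" using X by (simp add: carry_approx_def)
  have "load k t v \<le> (\<Sum>i\<in>{1..<k}. wcet (\<tau> i) - wcet (\<tau> i) * util (\<tau> i) + util (\<tau> i) * L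
      + (if carry_in i t \<and> util (\<tau> i) > \<rho> then f i else 0))"
    unfolding load_def
  proof (rule sum_mono)
    fix i assume i: "i \<in> {1..<k}"
    show "amount (busy i) t v \<le> wcet (\<tau> i) - wcet (\<tau> i) * util (\<tau> i) + util (\<tau> i) * L
      + (if carry_in i t \<and> util (\<tau> i) > \<rho> then f i else 0)"
      using higher_priority_work[of i k t v \<rho>] i assms(1) k \<open>D < L\<close> \<open>0 < D\<close> deadlines[OF i] below
      by (auto simp: f_def gamma_def L_def)
  qed
  also have "\<dots> = Y + V * L + sum f ?Z"
    by (simp add: Y_def V_def sum.distrib sum_distrib_right sum.If_cases Int_def)
  also have "sum f ?Z \<le> sum f X"
  proof (rule sum_le_sum_largest)
    have "real (card {i \<in> {1..<k}. carry_in i t}) < ?\<mu>"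
      by (rule card_carry_in_less) (use k \<open>0 < ?\<mu>\<close> \<open>?\<mu> \<le> real M\<close> below in auto)
    moreover have "card ?Z \<le> card {i \<in> {1..<k}. carry_in i t}" by (rule card_mono) auto
    ultimately have "real (card ?Z) < ?\<mu>" by linarith
    \<comment> \<open>An integer below \<open>?\<mu>\<close> is at most its ceiling minus one, also
      when \<open>?\<mu>\<close> is an integer.\<close>
    then have "card ?Z \<le> nat (\<lceil>?\<mu>\<rceil> - 1)" by linarith
    moreover have "card ?Z \<le> card ?H" by (rule card_mono) auto
    ultimately show "card ?Z \<le> card X" using X by (simp add: carry_approx_def)
    show "f z \<le> f x" if "x \<in> X" "z \<in> ?Z - X" for x z
      using X that unfolding carry_approx_def f_def by blast
    show "finite X" using XH by (rule finite_subset) simp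
    show "0 \<le> f x" if "x \<in> X" for x using f0 XH that by blast
  qed simp
  finally have "?\<mu> * L \<le> B + sum f X + Y + V * L" using t(2) by (simp add: L_def)
  moreover have "B + sum f X + Y \<le> (?\<mu> - V) * D"
  proof -
    have "B / D + sum f X / D + (Y / D + V) \<le> ?\<mu>"
      using test unfolding Y_def V_def f_def by (simp add: sum.distrib sum_divide_distrib)
    then have "(B + sum f X + Y) / D \<le> ?\<mu> - V" by (simp add: add_divide_distrib)
    then show ?thesis using \<open>0 < D\<close> by (simp add: pos_divide_le_eq)
  qed
  moreover have "0 < B + sum f X + Y"
  proof -
    have "0 \<le> sum f X" using f0 XH by (intro sum_nonneg) blast
    moreover have "0 \<le> Y"
      unfolding Y_def using params k by (intro sum_nonneg) (auto intro!: mult_left_le)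
    ultimately show ?thesis using \<open>0 < B\<close> by simp
  qed
  \<comment> \<open>A positive constant is at most \<open>(?\<mu> - V) * D\<close>, so the slope
    \<open>?\<mu> - V\<close> is positive and the longer window \<open>L\<close> gives a strictly
    larger bound.\<close>
  moreover from calculation(2,3) have "0 < ?\<mu> - V"
    using \<open>0 < D\<close> by (metis less_le_trans zero_less_mult_pos2)
  then have "(?\<mu> - V) * D < (?\<mu> - V) * L" using \<open>D < L\<close> by simp
  ultimately show False by (simp add: algebra_simps)
qed

end

section \<open>From single schedules to schedulability\<close>

theorem theorem4p4:
  fixes M n k :: nat and \<tau> :: "nat \<Rightarrow> task"
  assumes "M \<ge> 2"
    and "1 \<le> k" and "k \<le> n"
    and "\<And>i. i \<in> {1..n} \<Longrightarrow> valid_task (\<tau> i)"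
    and "\<And>i. i \<in> {1..<k} \<Longrightarrow> schedulable M n \<tau> i"
  shows "((\<forall>l\<ge>1. test_condition M \<tau> k l) \<longrightarrow> schedulable M n \<tau> k) \<and>
         (deadline (\<tau> k) \<le> period (\<tau> k) \<longrightarrow> test_condition M \<tau> k 1 \<longrightarrow> schedulable M n \<tau> k)"
proof -
  have k: "k \<in> {1..n}" using assms by simp
  have "c k j \<le> service M S k j (a k j + deadline (\<tau> k))"
    if test: "(\<forall>l\<ge>1. test_condition M \<tau> k l)
        \<or> deadline (\<tau> k) \<le> period (\<tau> k) \<and> test_condition M \<tau> k 1"
      and run: "legal_arrivals n \<tau> a" "legal_costs n \<tau> c" "gfp_schedule M n a c S"
    for a c S j
  proof -
    interpret gfp_run M n \<tau> a c S using assms(4) run by unfold_locales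
    have hp: "finished i j (a i j + deadline (\<tau> i))" if "i \<in> {1..<k}" for i j
      using assms(5)[OF that] run by (auto simp: schedulable_def)
    from test show ?thesis
    proof (elim disjE conjE)
      \<comment> \<open>The number of jobs in the busy period is not known in advance, hence the
        test for every \<open>l\<close>.\<close>
      assume all: "\<forall>l\<ge>1. test_condition M \<tau> k l"
      show ?thesis
      proof (rule ccontr)
        assume miss: "\<not> ?thesis"
        obtain q where "q \<le> j" "\<And>s. s \<in> {a k q..a k j + deadline (\<tau> k)} \<Longrightarrow> act k s"
          "\<And>r. r < q \<Longrightarrow> finished k r (a k q)"
          using busy_period_start[OF k miss] by blast
        then have "\<not> test_condition M \<tau> k (Suc (j - q))"
          using deadline_miss_imp_not_test[OF assms(1) k _ hp _ _ miss] by blast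
        then show False using all by simp
      qed
    next
      \<comment> \<open>By induction the jobs before \<open>j\<close> meet their deadlines, so they
        are finished when \<open>j\<close> arrives. The window can then start with \<open>j\<close>
        itself, which is the case \<open>l = 1\<close>.\<close>
      assume DT: "deadline (\<tau> k) \<le> period (\<tau> k)" and test1: "test_condition M \<tau> k 1"
      show ?thesis
      proof (induction j rule: less_induct)
        case (less j)
        show ?case
        proof (rule ccontr)
          assume miss: "\<not> ?thesis"
          have "finished k r (a k j)" if "r < j" for r
          proof -
            have "a k r + deadline (\<tau> k) \<le> a k j"
              using arrival_gap[OF k, of r 1] arrival_mono[OF k, of "Suc r" j] that DT by simp
            then show ?thesis using less[OF that] service_mono order_trans by blast
          qed
          then have "\<not> test_condition M \<tau> k (Suc (j - j))"
            using deadline_miss_imp_not_test[OF assms(1) k order_refl hp _ _ miss]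
              unfinished_imp_act[OF miss] by blast
          then show False using test1 by simp
        qed
      qed
    qed
  qed
  then show ?thesis by (auto simp: schedulable_def)
qed

end
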